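(* There exist absolute constants $c>0$ and $\varepsilon_0>0$ such that for every integer $m\ge 2$, every $0<\varepsilon<\varepsilon_0$, and every sufficiently large $n$ (depending on $m$ and $\varepsilon$), every non-adaptive $\varepsilon$-test for $\mathcal{S}_m$ over $\{0,1\}^n$ in the Huge Object model, even one with two-sided error, makes at least $c\,\varepsilon^{-1}\log \varepsilon^{-1}$ queries (in the worst case).
   Context: Huge Object model: the input is an unknown distribution $P$ over $\{0,1\}^n$. An algorithm may repeatedly draw independent samples $x\sim P$, but has no direct access to them; it may only query individual bits, i.e. ask for $x_j$ of an already drawn sample $x$. Its query complexity is the total number of bit queries. An algorithm is non-adaptive if all its sampling and querying decisions are fixed in advance (possibly using internal randomness) before any answer is received; only its final output depends on the answers. For $u,v\in\{0,1\}^n$, $d_H(u,v)=\frac1n|\{i:u_i\ne v_i\}|$. For distributions $P,Q$ over $\{0,1\}^n$, the earth mover's distance is $d(P,Q)=\min_T \mathbb{E}_{(u,v)\sim T}[d_H(u,v)]$ over all couplings $T$ of $P$ and $Q$. $\mathcal{S}_m$ is the property of distributions supported on at most $m$ elements; $d(P,\mathcal{S}_m)=\min_{Q\in\mathcal{S}_m}d(P,Q)$, and $P$ is $\varepsilon$-far from $\mathcal{S}_m$ if $d(P,\mathcal{S}_m)>\varepsilon$. An $\varepsilon$-test for $\mathcal{S}_m$ accepts every $P\in\mathcal{S}_m$ with probability greater than $2/3$ and rejects every $P$ that is $\varepsilon$-far from $\mathcal{S}_m$ with probability greater than $2/3$. *)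

theory Defs
  imports "HOL-Probability.Probability"
begin

section \<open>Distributions on the cube and earth mover's distance\<close>

definition cube :: "nat \<Rightarrow> bool list set" where
  "cube n = {x. length x = n}"

definition hamming_dist :: "nat \<Rightarrow> bool list \<Rightarrow> bool list \<Rightarrow> real" where
  "hamming_dist n u v = real (card {i. i < n \<and> u ! i \<noteq> v ! i}) / real n"

definition couplings :: "'a pmf \<Rightarrow> 'b pmf \<Rightarrow> ('a \<times> 'b) pmf set" where
  "couplings P Q = {T. map_pmf fst T = P \<and> map_pmf snd T = Q}"

text \<open>On distributions over a finite cube, the infima below range over nonempty compact sets
  (for \<open>m \<ge> 1\<close> in the case of \<open>dist_supp\<close>) and are therefore minima.\<close>

definition emd :: "nat \<Rightarrow> bool list pmf \<Rightarrow> bool list pmf \<Rightarrow> real" where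
  "emd n P Q =
    (INF T\<in>couplings P Q. measure_pmf.expectation T (\<lambda>(u, v). hamming_dist n u v))"

definition supp_at_most :: "nat \<Rightarrow> nat \<Rightarrow> bool list pmf set" where
  "supp_at_most n m = {Q. set_pmf Q \<subseteq> cube n \<and> card (set_pmf Q) \<le> m}"

definition dist_supp :: "nat \<Rightarrow> nat \<Rightarrow> bool list pmf \<Rightarrow> real" where
  "dist_supp n m P = (INF Q\<in>supp_at_most n m. emd n P Q)"


section \<open>Non-adaptive algorithms in the Huge Object model\<close>

text \<open>One outcome of the internal randomness fixes the number of samples, the list of bit
  queries, where \<open>(i, j)\<close> asks for bit \<open>j\<close> of sample \<open>i\<close>, and the map from the list
  of answers to the output (\<open>True\<close> is acceptance). A non-adaptive algorithm is a probability
  distribution over such plans. Discrete distributions lose no generality: up to the values of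
  \<open>decide\<close> on lists that are not possible answers, there are only countably many plans.\<close>

datatype plan =
  Plan (num_samples: nat) (queries: "(nat \<times> nat) list") (decide: "bool list \<Rightarrow> bool")

definition nonadaptive_alg :: "nat \<Rightarrow> plan pmf \<Rightarrow> bool" where
  "nonadaptive_alg n A \<longleftrightarrow>
    (\<forall>D\<in>set_pmf A. \<forall>(i, j)\<in>set (queries D). i < num_samples D \<and> j < n)"

definition run_alg :: "plan pmf \<Rightarrow> bool list pmf \<Rightarrow> bool pmf" where
  "run_alg A P =
    bind_pmf A (\<lambda>D. map_pmf (\<lambda>xs. decide D (map (\<lambda>(i, j). xs ! i ! j) (queries D)))
      (replicate_pmf (num_samples D) P))"

text \<open>The worst case is over the internal randomness only, since the queries of a non-adaptive
  algorithm do not depend on the input.\<close>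

definition query_complexity :: "plan pmf \<Rightarrow> ereal" where
  "query_complexity A = (SUP D\<in>set_pmf A. ereal (real (length (queries D))))"

definition nonadaptive_test :: "nat \<Rightarrow> nat \<Rightarrow> real \<Rightarrow> plan pmf \<Rightarrow> bool" where
  "nonadaptive_test n m \<epsilon> A \<longleftrightarrow>
    nonadaptive_alg n A \<and>
    (\<forall>P\<in>supp_at_most n m. pmf (run_alg A P) True > 2 / 3) \<and>
    (\<forall>P. set_pmf P \<subseteq> cube n \<and> dist_supp n m P > \<epsilon> \<longrightarrow> pmf (run_alg A P) False > 2 / 3)"

end

theory Submission
  imports Defs
begin

text \<open>Fix a scale \<open>k\<close> with \<open>2\<^sup>k \<lesssim> 1 / \<epsilon>\<close>, and let the active columns be a random residue class modulo
  \<open>2\<^sup>k\<close>. A sample is zero except with probability \<open>p = 32 \<epsilon> 2\<^sup>k\<close>; a nonzero sample lives on the active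
  columns and is there either a fixed uniformly random string \<open>r\<close>, or one of \<open>2 m\<close> translates of
  \<open>r\<close> by words of a code of constant relative distance. The first distribution has support size
  two, the second is \<open>\<epsilon>\<close>-far from support size \<open>m\<close>, because about half of the translates are far
  from any \<open>m\<close> given strings. The two are indistinguishable unless some active column is queried in
  two nonzero samples. A column with \<open>d\<close> queries causes this with probability at most
  \<open>2\<^sup>-\<^sup>k min 1 ((d p)\<^sup>2)\<close>, and the sum over all \<open>k\<close> is \<open>O(\<epsilon> d)\<close>. As there are about
  \<open>log (1 / \<epsilon>)\<close> scales, some scale is missed by every algorithm with \<open>o(\<epsilon>\<^sup>-\<^sup>1 log \<epsilon>\<^sup>-\<^sup>1)\<close> queries.\<close>

section \<open>Independent samples and their marginals\<close>

lemma replicate_map_pmf: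
  "replicate_pmf N (map_pmf f p) = map_pmf (map f) (replicate_pmf N p)"
proof (induction N)
  case (Suc N)
  then show ?case
    by (simp add: bind_map_pmf map_bind_pmf map_pmf_def bind_assoc_pmf bind_return_pmf)
qed simp

lemma finite_set_replicate_pmf:
  assumes "finite (set_pmf p)"
  shows "finite (set_pmf (replicate_pmf N p))"
  using finite_lists_length_eq[OF assms, of N] by (simp add: set_replicate_pmf lists_eq_set)

lemma replicate_pmf_Suc_map:
  "replicate_pmf (Suc N) p = bind_pmf p (\<lambda>x. map_pmf ((#) x) (replicate_pmf N p))"
  by (simp add: map_pmf_def)

lemma map_nth_replicate_pmf:
  assumes "i < N"
  shows "map_pmf (\<lambda>xs. xs ! i) (replicate_pmf N p) = p"
  using assms
proof (induction N arbitrary: i)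
  case (Suc N)
  then show ?case
    by (cases i) (simp_all add: replicate_pmf_Suc_map map_bind_pmf map_pmf_comp bind_return_pmf'
        del: replicate_pmf.simps)
qed simp

lemma map_two_nth_replicate_pmf:
  assumes "i < i'" "i' < N"
  shows "map_pmf (\<lambda>xs. (xs ! i, xs ! i')) (replicate_pmf N p) = pair_pmf p p"
  using assms
proof (induction N arbitrary: i i')
  case (Suc N)
  then obtain l where l: "i' = Suc l" "l < N"
    by (cases i') auto
  show ?case
  proof (cases i)
    case 0
    have "map_pmf (\<lambda>xs. (xs ! i, xs ! i')) (replicate_pmf (Suc N) p)
        = bind_pmf p (\<lambda>x. map_pmf (\<lambda>y. (x, y)) (map_pmf (\<lambda>xs. xs ! l) (replicate_pmf N p)))"
      by (simp add: 0 l replicate_pmf_Suc_map map_bind_pmf map_pmf_comp del: replicate_pmf.simps)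
    also have "\<dots> = pair_pmf p p"
      by (simp only: map_nth_replicate_pmf[OF l(2)]) (simp add: pair_pmf_def map_pmf_def)
    finally show ?thesis .
  next
    case i: (Suc l')
    then have "map_pmf (\<lambda>xs. (xs ! l', xs ! l)) (replicate_pmf N p) = pair_pmf p p"
      using Suc l by simp
    then show ?thesis
      by (simp add: i l replicate_pmf_Suc_map map_bind_pmf map_pmf_comp del: replicate_pmf.simps)
  qed
qed simp

lemma measure_pair_pmf_Times:
  "measure (pair_pmf p q) (A \<times> B) = measure p A * measure q B"
proof -
  \<comment> \<open>The product rule for measures of rectangles is for countable sets, so both sides
    are first cut down to the supports.\<close>
  have "measure (pair_pmf p q) (A \<times> B)
      = measure (pair_pmf p q) ((A \<inter> set_pmf p) \<times> (B \<inter> set_pmf q))"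
    by (subst measure_Int_set_pmf[symmetric]) (rule arg_cong[where f = "measure _"], auto)
  also have "\<dots> = measure p A * measure q B"
    by (simp add: measure_pmf_prob_product measure_Int_set_pmf)
  finally show ?thesis .
qed

lemma prob_two_nth_replicate_pmf:
  assumes "i \<noteq> i'" "i < N" "i' < N"
  shows "measure (replicate_pmf N p) {xs. xs ! i \<in> A \<and> xs ! i' \<in> A} = (measure p A)\<^sup>2"
proof -
  have *: "measure (replicate_pmf N p) {xs. xs ! a \<in> A \<and> xs ! b \<in> A} = (measure p A)\<^sup>2"
    if "a < b" "b < N" for a b
  proof -
    have "measure (replicate_pmf N p) {xs. xs ! a \<in> A \<and> xs ! b \<in> A}
        = measure (map_pmf (\<lambda>xs. (xs ! a, xs ! b)) (replicate_pmf N p)) (A \<times> A)"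
      by (simp add: vimage_def)
    also have "\<dots> = (measure p A)\<^sup>2"
      by (simp add: map_two_nth_replicate_pmf[OF that] measure_pair_pmf_Times power2_eq_square)
    finally show ?thesis .
  qed
  show ?thesis
    using *[of i i'] *[of i' i] assms by (cases "i < i'") (auto simp: conj_commute)
qed

section \<open>Summation over the scales\<close>

text \<open>The terms grow like \<open>x^2 * 2^k\<close> until \<open>2^k\<close> reaches
  \<open>1/x\<close> and then decay like \<open>2^-k\<close>. Both geometric series are dominated by
  their peak of order \<open>x\<close>, so the bound does not depend on \<open>K\<close>.\<close>

lemma sum_scales:
  fixes x :: real
  assumes "x \<ge> 0"
  shows "(\<Sum>k<K. min 1 ((x * 2 ^ k)\<^sup>2) / 2 ^ k) \<le> 4 * x"
proof -
  let ?f = "\<lambda>K x. \<Sum>k<K. min 1 ((x * 2 ^ k)\<^sup>2) / 2 ^ k :: real"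
  have large: "?f K x \<le> 2" for K x
  proof -
    have "?f K x \<le> (\<Sum>k<K. (1 / 2) ^ k)"
      by (intro sum_mono) (simp add: power_one_over divide_right_mono)
    also have "\<dots> \<le> 2"
      by (simp add: sum_gp_strict)
    finally show ?thesis .
  qed
  \<comment> \<open>The correction \<open>- x^2\<close> makes the induction close: splitting off the
    term \<open>k = 0\<close> gives \<open>x^2 + ?f K (2 * x) / 2\<close>, and
    \<open>x^2 + (8 * x - 4 * x^2) / 2 = 4 * x - x^2\<close>.\<close>
  have "?f K x \<le> 4 * x - x\<^sup>2" if "0 \<le> x" "x \<le> 1" for x
    using that
  proof (induction K arbitrary: x)
    case 0
    then show ?case by (simp add: power2_eq_square mult_le_one) (smt (verit) mult_left_le)
  next
    case (Suc K)
    have "?f (Suc K) x = min 1 (x\<^sup>2) + (\<Sum>k<K. min 1 ((x * 2 ^ Suc k)\<^sup>2) / 2 ^ Suc k)"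
      by (subst sum.lessThan_Suc_shift) simp
    also have "(\<Sum>k<K. min 1 ((x * 2 ^ Suc k)\<^sup>2) / 2 ^ Suc k) = ?f K (2 * x) / 2"
      by (simp add: sum_divide_distrib mult_ac)
    finally have eq: "?f (Suc K) x = x\<^sup>2 + ?f K (2 * x) / 2"
      using Suc.prems by (simp add: power_le_one min_absorb2)
    show ?case
    proof (cases "2 * x \<le> 1")
      case True
      have "?f K (2 * x) \<le> 4 * (2 * x) - (2 * x)\<^sup>2"
        using Suc.IH[of "2 * x"] Suc.prems True by simp
      then show ?thesis using eq by (simp add: power_mult_distrib)
    next
      case False
      \<comment> \<open>Past the peak the bound \<open>large\<close> leaves
        \<open>x^2 + 1 \<le> 4 * x - x^2\<close> to show, and the difference of the two sides is
        this product plus \<open>x\<close>.\<close>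
      have "0 \<le> (2 * x - 1) * (1 - x)" using False Suc.prems by simp
      then show ?thesis using eq large[where K = K and x = "2 * x"] False
        by (simp add: power2_eq_square algebra_simps)
    qed
  qed
  from this[of x] large[where K = K and x = x] assms show ?thesis
    by (cases "x \<le> 1") (auto intro: order_trans)
qed

section \<open>Relative distance of the code\<close>

text \<open>Flipping bit \<open>i\<close> is an involution that exchanges the numbers whose two bits
  differ with those whose two bits agree.\<close>

lemma card_differing_bits:
  assumes "i \<noteq> i'" "i < M" "i' < M"
  shows "2 * card {t::nat. t < 2 ^ M \<and> bit t i \<noteq> bit t i'} = 2 ^ M"
proof -
  let ?A = "{t::nat. t < 2 ^ M \<and> bit t i \<noteq> bit t i'}"
  let ?B = "{t::nat. t < 2 ^ M \<and> bit t i = bit t i'}"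
  have flip: "flip_bit i t < 2 ^ M" if "t < 2 ^ M" for t :: nat
    using that assms take_bit_flip_bit_eq[of M i t]
    by (metis leD take_bit_nat_eq_self_iff)
  have inv: "flip_bit i (flip_bit i t) = t" for t :: nat
    by (rule bit_eqI) (auto simp: bit_flip_bit_iff)
  have "bij_betw (flip_bit i) ?A ?B"
    by (rule bij_betw_byWitness[where f' = "flip_bit i"])
      (use assms in \<open>auto simp: inv flip bit_flip_bit_iff\<close>)
  then have "card ?A = card ?B" by (rule bij_betw_same_card)
  moreover have "card ?A + card ?B = card (?A \<union> ?B)"
    by (rule card_Un_disjoint[symmetric]) auto
  moreover have "?A \<union> ?B = {..<2 ^ M}" by auto
  ultimately show ?thesis by simp
qed

text \<open>A fraction \<open>2^-k\<close> of the columns is active and two words differ on half of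
  a full block of them; one more factor 2 is lost by discarding an incomplete last block.\<close>

lemma card_differing_positions:
  assumes "i \<noteq> i'" "i < M" "i' < M" "s < 2 ^ k" "2 ^ (k + M) \<le> n"
  shows "real n / (4 * 2 ^ k)
    \<le> real (card {j. j < n \<and> j mod 2 ^ k = s \<and> bit (j div 2 ^ k) i \<noteq> bit (j div 2 ^ k) i'})"
    (is "_ \<le> real (card ?S)")
proof -
  let ?A = "{t::nat. t < 2 ^ M \<and> bit t i \<noteq> bit t i'}"
  define B where "B = n div 2 ^ (k + M)"
  \<comment> \<open>Binary layout of a column: the low \<open>k\<close> bits hold the residue
    \<open>s\<close>, the next \<open>M\<close> bits hold \<open>t\<close>, and the rest numbers one
    of the \<open>B\<close> full blocks.\<close>
  define g where "g = (\<lambda>(b, t). (b * 2 ^ M + t) * 2 ^ k + s)"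
  have inj: "inj_on g ({..<B} \<times> ?A)"
  proof (rule inj_onI, clarify)
    fix b t b' t' :: nat
    assume t: "t < 2 ^ M" "t' < 2 ^ M" and "g (b, t) = g (b', t')"
    then have "(b * 2 ^ M + t) = b' * 2 ^ M + t'" by (simp add: g_def)
    then have "(b * 2 ^ M + t) div 2 ^ M = (b' * 2 ^ M + t') div 2 ^ M"
      "(b * 2 ^ M + t) mod 2 ^ M = (b' * 2 ^ M + t') mod 2 ^ M" by simp_all
    then show "b = b' \<and> t = t'" using t by simp
  qed
  have "g ` ({..<B} \<times> ?A) \<subseteq> ?S"
  proof (rule image_subsetI, clarify)
    fix b t :: nat
    assume b: "b < B" and t: "t < 2 ^ M" "bit t i \<noteq> bit t i'"
    have "bit (b * 2 ^ M + t) l = bit t l" if "l < M" for l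
    proof -
      have "take_bit M (b * 2 ^ M + t) = take_bit M t" by (simp add: take_bit_eq_mod)
      then show ?thesis using that by (metis bit_take_bit_iff)
    qed
    moreover have "g (b, t) mod 2 ^ k = s" "g (b, t) div 2 ^ k = b * 2 ^ M + t"
      using assms by (simp_all add: g_def)
    moreover have "g (b, t) < n"
    proof -
      have "b * 2 ^ M + t + 1 \<le> (b + 1) * 2 ^ M" using t by simp
      then have "(b * 2 ^ M + t + 1) * 2 ^ k \<le> (b + 1) * 2 ^ M * 2 ^ k" by (rule mult_le_mono1)
      also have "\<dots> \<le> B * 2 ^ (k + M)" using mult_le_mono1[of "b + 1" B "2 ^ M * 2 ^ k"] b
        by (simp only: power_add mult.assoc mult.commute[of "2 ^ k"])
      also have "\<dots> \<le> n" by (simp add: B_def)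
      finally show ?thesis using assms by (simp add: g_def)
    qed
    ultimately show "g (b, t) < n \<and> g (b, t) mod 2 ^ k = s \<and>
        bit (g (b, t) div 2 ^ k) i \<noteq> bit (g (b, t) div 2 ^ k) i'"
      using assms t by simp
  qed
  then have "card ({..<B} \<times> ?A) \<le> card ?S"
    by (rule card_inj_on_le[OF inj]) simp
  then have 1: "B * card ?A \<le> card ?S" by (simp add: card_cartesian_product)
  have "n < (B + 1) * 2 ^ (k + M)"
    using dividend_less_div_times[of "2 ^ (k + M)" n] by (simp add: B_def algebra_simps)
  \<comment> \<open>There is at least one full block since \<open>2^(k+M) \<le> n\<close>, hence
    \<open>B + 1 \<le> 2 * B\<close>.\<close>
  also have "\<dots> \<le> 2 * B * 2 ^ (k + M)"
    using assms by (intro mult_le_mono1) (simp add: B_def Suc_le_eq div_greater_zero_iff)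
  finally have "n \<le> 2 * B * 2 ^ (k + M)" by simp
  also have "\<dots> = 4 * 2 ^ k * (B * card ?A)"
    using card_differing_bits[OF assms(1-3)] by (simp add: power_add)
  also have "\<dots> \<le> 4 * 2 ^ k * card ?S" using 1 by simp
  finally have "real n \<le> 4 * 2 ^ k * real (card ?S)"
    by (simp flip: of_nat_le_iff[where 'a = real])
  then show ?thesis by (simp add: field_simps)
qed

section \<open>Hamming distance and lower bounds on the earth mover's distance\<close>

lemma hamming_dist_nonneg: "hamming_dist n u v \<ge> 0"
  by (simp add: hamming_dist_def)

lemma hamming_dist_commute: "hamming_dist n u v = hamming_dist n v u"
  by (simp add: hamming_dist_def eq_commute)

lemma hamming_dist_triangle: "hamming_dist n u w \<le> hamming_dist n u v + hamming_dist n v w"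
proof -
  have "card {i. i < n \<and> u ! i \<noteq> w ! i}
      \<le> card ({i. i < n \<and> u ! i \<noteq> v ! i} \<union> {i. i < n \<and> v ! i \<noteq> w ! i})"
    by (rule card_mono) auto
  also have "\<dots> \<le> card {i. i < n \<and> u ! i \<noteq> v ! i} + card {i. i < n \<and> v ! i \<noteq> w ! i}"
    by (rule card_Un_le)
  finally have "real (card {i. i < n \<and> u ! i \<noteq> w ! i})
      \<le> real (card {i. i < n \<and> u ! i \<noteq> v ! i}) + real (card {i. i < n \<and> v ! i \<noteq> w ! i})"
    by linarith
  then show ?thesis
    by (simp add: hamming_dist_def divide_right_mono flip: add_divide_distrib)
qed

lemma finite_cube: "finite (cube n)"
  using finite_lists_length_eq[of "UNIV :: bool set" n] by (simp add: cube_def)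

lemma card_cube: "card (cube n) = 2 ^ n"
  using card_lists_length_eq[of "UNIV :: bool set" n] by (simp add: cube_def)

text \<open>With \<open>V\<close> the support of a competitor \<open>Q\<close>, every coupling pairs
  the far strings, of mass at least \<open>\<mu>\<close>, with elements of \<open>V\<close>, and so
  pays at least \<open>\<eta>\<close> on that mass.\<close>

lemma dist_supp_ge:
  assumes P: "set_pmf P \<subseteq> cube n" and "m \<ge> 1" "\<eta> \<ge> 0"
    and far: "\<And>V. finite V \<Longrightarrow> card V \<le> m \<Longrightarrow>
      measure P {u. \<forall>v\<in>V. \<eta> \<le> hamming_dist n u v} \<ge> \<mu>"
  shows "dist_supp n m P \<ge> \<eta> * \<mu>"
proof -
  \<comment> \<open>An infimum is bounded below by \<open>cINF_greatest\<close> only over a nonempty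
    set; this point mass and, below, the independent coupling are the members.\<close>
  have "return_pmf (replicate n False) \<in> supp_at_most n m"
    using assms by (simp add: supp_at_most_def cube_def)
  moreover have "\<eta> * \<mu> \<le> emd n P Q" if Q: "Q \<in> supp_at_most n m" for Q
    unfolding emd_def
  proof (rule cINF_greatest)
    have "pair_pmf P Q \<in> couplings P Q"
      by (simp add: couplings_def map_fst_pair_pmf map_snd_pair_pmf)
    then show "couplings P Q \<noteq> {}" by blast
  next
    fix T
    assume "T \<in> couplings P Q"
    then have T: "map_pmf fst T = P" "map_pmf snd T = Q"
      by (auto simp: couplings_def)
    have Qfin: "finite (set_pmf Q)" and Qcard: "card (set_pmf Q) \<le> m"
      using Q finite_subset[OF _ finite_cube] by (auto simp: supp_at_most_def)
    have "set_pmf T \<subseteq> set_pmf P \<times> set_pmf Q"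
      using T by (force simp: image_iff)
    then have finT: "finite (set_pmf T)"
      using Qfin P finite_subset[OF P finite_cube] by (metis finite_SigmaI finite_subset)
    let ?F = "{u. \<forall>v\<in>set_pmf Q. \<eta> \<le> hamming_dist n u v}"
    have "\<eta> * \<mu> \<le> \<eta> * measure P ?F"
      using far[OF Qfin Qcard] \<open>\<eta> \<ge> 0\<close> by (rule mult_left_mono)
    also have "\<dots> = measure_pmf.expectation T (\<lambda>x. \<eta> * indicator (fst -` ?F) x)"
      by (simp flip: T(1))
    also have "\<dots> \<le> measure_pmf.expectation T (\<lambda>(u, v). hamming_dist n u v)"
    proof (rule integral_mono_AE)
      have "snd x \<in> set_pmf Q" if "x \<in> set_pmf T" for x
        using that by (simp flip: T(2))
      then show "AE x in T. \<eta> * indicator (fst -` ?F) x \<le> (\<lambda>(u, v). hamming_dist n u v) x"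
        by (auto simp: AE_measure_pmf_iff indicator_def hamming_dist_nonneg)
    qed (simp_all add: integrable_measure_pmf_finite finT)
    finally show "\<eta> * \<mu> \<le> measure_pmf.expectation T (\<lambda>(u, v). hamming_dist n u v)" .
  qed
  ultimately show ?thesis
    unfolding dist_supp_def by (intro cINF_greatest) auto
qed

text \<open>By the triangle inequality no element of \<open>V\<close> is within
  \<open>\<eta>\<close> of two of the words, so at most \<open>m\<close> of the \<open>2 * m\<close>
  words are near \<open>V\<close>.\<close>

lemma card_far_from_few:
  assumes "finite V" "card V \<le> m"
    and sep: "\<And>i i'. i < 2 * m \<Longrightarrow> i' < 2 * m \<Longrightarrow> i \<noteq> i' \<Longrightarrow>
      2 * \<eta> \<le> hamming_dist n (f i) (f i')"
  shows "m \<le> card {i. i < 2 * m \<and> (\<forall>v\<in>V. \<eta> \<le> hamming_dist n (f i) v)}"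
proof -
  let ?near = "{i. i < 2 * m \<and> (\<exists>v\<in>V. hamming_dist n (f i) v < \<eta>)}"
  let ?far = "{i. i < 2 * m \<and> (\<forall>v\<in>V. \<eta> \<le> hamming_dist n (f i) v)}"
  obtain g where g: "\<And>i. i \<in> ?near \<Longrightarrow> g i \<in> V \<and> hamming_dist n (f i) (g i) < \<eta>"
    using bchoice[of ?near "\<lambda>i v. v \<in> V \<and> hamming_dist n (f i) v < \<eta>"] by auto
  have "inj_on g ?near"
  proof (rule inj_onI, rule ccontr)
    fix i i'
    assume i: "i \<in> ?near" "i' \<in> ?near" "g i = g i'" "i \<noteq> i'"
    have "2 * \<eta> \<le> hamming_dist n (f i) (f i')" using i by (intro sep) auto
    also have "\<dots> \<le> hamming_dist n (f i) (g i) + hamming_dist n (g i) (f i')"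
      by (rule hamming_dist_triangle)
    also have "\<dots> < 2 * \<eta>"
      using g[OF i(1)] g[OF i(2)] i(3) by (simp add: hamming_dist_commute)
    finally show False by simp
  qed
  moreover have "g ` ?near \<subseteq> V" using g by blast
  ultimately have "card ?near \<le> m"
    using assms(1,2) by (meson card_inj_on_le le_trans)
  moreover have "card ?near + card ?far = card (?near \<union> ?far)"
    by (rule card_Un_disjoint[symmetric]) force+
  moreover have "?near \<union> ?far = {..<2 * m}" by force
  ultimately show ?thesis by simp
qed

section \<open>The two families of distributions\<close>

text \<open>A source symbol \<open>(z, i)\<close> says whether the sample is nonzero and which word of the code it uses.
  The zero code \<open>\<lambda>_ _. False\<close> gives the distribution of small support.\<close>

definition source :: "real \<Rightarrow> nat \<Rightarrow> (bool \<times> nat) pmf" where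
  "source p M = pair_pmf (bernoulli_pmf p) (pmf_of_set {..<M})"

definition codeword ::
  "nat \<Rightarrow> nat \<Rightarrow> nat \<Rightarrow> (nat \<Rightarrow> nat \<Rightarrow> bool) \<Rightarrow> bool list \<Rightarrow> bool \<times> nat \<Rightarrow> bool list" where
  "codeword n k s c r w = map (\<lambda>j. j mod 2 ^ k = s \<and> fst w \<and> r ! j \<noteq> c (snd w) j) [0..<n]"

text \<open>Along the active columns, word \<open>i\<close> is the truth table of the
  \<open>i\<close>-th coordinate function, repeated periodically. Distinct coordinate functions
  disagree on half of their inputs.\<close>

abbreviation bit_code :: "nat \<Rightarrow> nat \<Rightarrow> nat \<Rightarrow> bool" where
  "bit_code k i j \<equiv> bit (j div 2 ^ k) i"

lemma length_codeword [simp]: "length (codeword n k s c r w) = n"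
  by (simp add: codeword_def)

lemma nth_codeword:
  "j < n \<Longrightarrow> codeword n k s c r w ! j \<longleftrightarrow> j mod 2 ^ k = s \<and> fst w \<and> r ! j \<noteq> c (snd w) j"
  by (simp add: codeword_def)

lemma set_source: "M > 0 \<Longrightarrow> set_pmf (source p M) \<subseteq> UNIV \<times> {..<M}"
  by (auto simp: source_def set_pmf_of_set lessThan_empty_iff)

lemma finite_set_source: "M > 0 \<Longrightarrow> finite (set_pmf (source p M))"
  by (rule finite_subset[OF set_source]) auto

lemma prob_source_True:
  assumes "0 \<le> p" "p \<le> 1" "M > 0"
  shows "measure (source p M) {w. fst w} = p"
proof -
  have "{w :: bool \<times> nat. fst w} = {True} \<times> UNIV" by auto
  then show ?thesis
    using assms by (simp add: source_def measure_pair_pmf_Times measure_pmf_single)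
qed

text \<open>The zero code ignores the word index, so only the flag matters: the sample is either the
  zero string or \<open>r\<close> cut down to the active columns.\<close>

lemma codeword_zero_code_in_supp_at_most:
  assumes "m \<ge> 2"
  shows "map_pmf (codeword n k s (\<lambda>_ _. False) r) W \<in> supp_at_most n m"
proof -
  let ?f = "codeword n k s (\<lambda>_ _. False) r"
  have "?f ` set_pmf W \<subseteq> {?f (True, 0), ?f (False, 0)}"
    by (auto simp: codeword_def)
  then have "card (?f ` set_pmf W) \<le> card {?f (True, 0), ?f (False, 0)}"
    by (intro card_mono) auto
  also have "\<dots> \<le> 2" by (simp add: card_insert_if)
  finally show ?thesis
    using assms by (auto simp: supp_at_most_def cube_def)
qed

lemma hamming_dist_codeword:
  assumes "i \<noteq> i'" "i < M" "i' < M" "s < 2 ^ k" "2 ^ (k + M) \<le> n"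
  shows "1 / (4 * 2 ^ k)
    \<le> hamming_dist n (codeword n k s (bit_code k) r (True, i)) (codeword n k s (bit_code k) r (True, i'))"
proof -
  have "{j. j < n \<and> codeword n k s (bit_code k) r (True, i) ! j
          \<noteq> codeword n k s (bit_code k) r (True, i') ! j}
      = {j. j < n \<and> j mod 2 ^ k = s \<and> bit_code k i j \<noteq> bit_code k i' j}"
    by (auto simp: nth_codeword)
  moreover have "n > 0" using assms(5) by (metis gr0I leD pos2 zero_less_power)
  ultimately show ?thesis
    using card_differing_positions[OF assms] by (simp add: hamming_dist_def field_simps)
qed

lemma dist_supp_bit_code:
  assumes "m \<ge> 1" "0 \<le> p" "p \<le> 1" "s < 2 ^ k" "2 ^ (k + 2 * m) \<le> n"
  shows "p / (16 * 2 ^ k)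
    \<le> dist_supp n m (map_pmf (codeword n k s (bit_code k) r) (source p (2 * m)))"
proof -
  let ?f = "codeword n k s (bit_code k) r"
  \<comment> \<open>Half the distance between codewords, as \<open>card_far_from_few\<close> asks.
    The mass of the far strings is at least \<open>p / 2\<close>: a sample is nonzero with
    probability \<open>p\<close>, and then at least half of the words are far.\<close>
  let ?\<eta> = "1 / (8 * 2 ^ k) :: real"
  have "?\<eta> * (p / 2) \<le> dist_supp n m (map_pmf ?f (source p (2 * m)))"
  proof (rule dist_supp_ge)
    show "set_pmf (map_pmf ?f (source p (2 * m))) \<subseteq> cube n"
      by (auto simp: cube_def)
  next
    fix V :: "bool list set"
    assume V: "finite V" "card V \<le> m"
    let ?far = "{i. i < 2 * m \<and> (\<forall>v\<in>V. ?\<eta> \<le> hamming_dist n (?f (True, i)) v)}"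
    have "m \<le> card ?far"
      using V hamming_dist_codeword[where M = "2 * m" and k = k and s = s and r = r and n = n] assms
      by (intro card_far_from_few) auto
    then have "1 / 2 \<le> real (card ?far) / real (2 * m)"
      using assms by (simp add: field_simps)
    also have "\<dots> = measure (pmf_of_set {..<2 * m}) ?far"
      using assms by (subst measure_pmf_of_set) (auto simp: lessThan_empty_iff intro!: arg_cong[where f = card])
    finally have "p / 2 \<le> p * measure (pmf_of_set {..<2 * m}) ?far"
      using mult_left_mono[of "1 / 2" _ p] assms by simp
    also have "\<dots> = measure (source p (2 * m)) ({True} \<times> ?far)"
      using assms by (simp add: source_def measure_pair_pmf_Times measure_pmf_single)
    also have "\<dots> \<le> measure (source p (2 * m)) (?f -` {u. \<forall>v\<in>V. ?\<eta> \<le> hamming_dist n u v})"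
      by (intro measure_pmf.finite_measure_mono) auto
    finally show "p / 2 \<le> measure (map_pmf ?f (source p (2 * m))) {u. \<forall>v\<in>V. ?\<eta> \<le> hamming_dist n u v}"
      by simp
  qed (use assms in auto)
  then show ?thesis by simp
qed

section \<open>Collisions\<close>

definition accept_prob :: "plan \<Rightarrow> bool list pmf \<Rightarrow> real" where
  "accept_prob D P = measure (replicate_pmf (num_samples D) P)
    {xs. decide D (map (\<lambda>(i, j). xs ! i ! j) (queries D))}"

lemma accept_prob_bounds: "0 \<le> accept_prob D P" "accept_prob D P \<le> 1"
  by (simp_all add: accept_prob_def)

lemma pmf_run_alg: "pmf (run_alg A P) True = measure_pmf.expectation A (\<lambda>D. accept_prob D P)"
  by (simp add: run_alg_def pmf_bind pmf_map accept_prob_def vimage_def)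

text \<open>The test accepts \<open>P\<close> with probability above 2/3 and \<open>P'\<close> with
  probability below 1/3; both are averages over the internal randomness of the acceptance
  probability of a fixed plan.\<close>

lemma nonadaptive_test_gap:
  assumes "nonadaptive_test n m \<epsilon> A" "P \<in> supp_at_most n m"
    "set_pmf P' \<subseteq> cube n" "dist_supp n m P' > \<epsilon>"
  shows "1 / 3 < measure_pmf.expectation A (\<lambda>D. accept_prob D P - accept_prob D P')"
proof -
  have "pmf (run_alg A P) True > 2 / 3" "pmf (run_alg A P') False > 2 / 3"
    using assms unfolding nonadaptive_test_def by blast+
  then have "1 / 3 < pmf (run_alg A P) True - pmf (run_alg A P') True"
    by (simp add: pmf_False_conv_True)
  then show ?thesis
    by (simp add: pmf_run_alg Bochner_Integration.integral_diff
        measure_pmf.integrable_const_bound[where B = 1] accept_prob_bounds)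
qed

text \<open>The answers as a function of the source symbols instead of the samples, so that the same
  \<open>ws\<close> can drive both distributions.\<close>

definition answers ::
  "nat \<Rightarrow> nat \<Rightarrow> (nat \<Rightarrow> nat \<Rightarrow> bool) \<Rightarrow> plan \<Rightarrow> bool list \<Rightarrow> (bool \<times> nat) list \<Rightarrow> bool list" where
  "answers k s c D r ws = map (\<lambda>(i, j). j mod 2 ^ k = s \<and> fst (ws ! i) \<and> r ! j \<noteq> c (snd (ws ! i)) j)
    (queries D)"

text \<open>Involves neither \<open>r\<close> nor the code, so its probability can be bounded after
  averaging over \<open>r\<close>.\<close>

definition collision :: "nat \<Rightarrow> nat \<Rightarrow> plan \<Rightarrow> nat \<Rightarrow> (bool \<times> nat) list \<Rightarrow> bool" where
  "collision k s D j ws \<longleftrightarrow> j mod 2 ^ k = s \<and>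
    (\<exists>i i'. i \<noteq> i' \<and> (i, j) \<in> set (queries D) \<and> (i', j) \<in> set (queries D) \<and> fst (ws ! i) \<and> fst (ws ! i'))"

abbreviation valid_plan :: "nat \<Rightarrow> plan \<Rightarrow> bool" where
  "valid_plan n D \<equiv> \<forall>(i, j)\<in>set (queries D). i < num_samples D \<and> j < n"

lemma accept_prob_codeword:
  assumes "valid_plan n D"
  shows "accept_prob D (map_pmf (codeword n k s c r) W)
    = measure_pmf.expectation (replicate_pmf (num_samples D) W)
        (\<lambda>ws. of_bool (decide D (answers k s c D r ws)))"
proof -
  let ?f = "codeword n k s c r"
  \<comment> \<open>Validity of the plan keeps both list lookups in range.\<close>
  have eq: "map (\<lambda>(i, j). map ?f ws ! i ! j) (queries D) = answers k s c D r ws"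
    if "length ws = num_samples D" for ws
    unfolding answers_def using assms that by (intro map_cong refl) (auto simp: nth_codeword)
  have "accept_prob D (map_pmf ?f W)
      = measure (replicate_pmf (num_samples D) W)
          {ws. decide D (map (\<lambda>(i, j). map ?f ws ! i ! j) (queries D))}"
    by (simp add: accept_prob_def replicate_map_pmf vimage_def)
  also have "\<dots> = measure (replicate_pmf (num_samples D) W) {ws. decide D (answers k s c D r ws)}"
    using eq by (intro measure_pmf.finite_measure_eq_AE) (auto simp: AE_measure_pmf_iff set_replicate_pmf)
  also have "\<dots> = measure_pmf.expectation (replicate_pmf (num_samples D) W)
        (indicator {ws. decide D (answers k s c D r ws)})"
    by simp
  also have "indicator {ws. decide D (answers k s c D r ws)}
      = (\<lambda>ws. of_bool (decide D (answers k s c D r ws)))"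
    by (auto simp: indicator_def)
  finally show ?thesis .
qed

text \<open>Without collisions each active column is read in at most one nonzero sample, and translating
  \<open>r\<close> in that column by the bit of that sample's codeword undoes the code.\<close>

lemma sum_accept_no_collision:
  assumes "valid_plan n D" and no: "\<And>j. \<not> collision k s D j ws"
  shows "(\<Sum>r\<in>cube n. of_bool (decide D (answers k s c D r ws)) :: real)
    = (\<Sum>r\<in>cube n. of_bool (decide D (answers k s (\<lambda>_ _. False) D r ws)))"
proof -
  \<comment> \<open>On a queried active column, \<open>h j\<close> is the code bit of the only
    nonzero sample read there, and False if there is none. On inactive columns its value is
    harmless, as the answer is False under both codes.\<close>
  define h where "h j \<longleftrightarrow> (\<exists>i. (i, j) \<in> set (queries D) \<and> fst (ws ! i) \<and> c (snd (ws ! i)) j)" for j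
  define T where "T r = map (\<lambda>j. r ! j \<noteq> h j) [0..<n]" for r
  have T: "T r \<in> cube n" for r
    by (simp add: T_def cube_def)
  have TT: "T (T r) = r" if "r \<in> cube n" for r
    using that by (auto simp: T_def cube_def intro!: nth_equalityI)
  have ans: "answers k s c D (T r) ws = answers k s (\<lambda>_ _. False) D r ws" for r
    unfolding answers_def
  proof (rule map_cong[OF refl], clarify)
    fix i j
    assume ij: "(i, j) \<in> set (queries D)"
    have "h j \<longleftrightarrow> c (snd (ws ! i)) j" if "j mod 2 ^ k = s" "fst (ws ! i)"
      using no[of j] ij that unfolding h_def collision_def by metis
    moreover have "T r ! j \<longleftrightarrow> r ! j \<noteq> h j"
      using assms(1) ij by (auto simp: T_def)
    ultimately show "(j mod 2 ^ k = s \<and> fst (ws ! i) \<and> T r ! j \<noteq> c (snd (ws ! i)) j)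
        = (j mod 2 ^ k = s \<and> fst (ws ! i) \<and> r ! j \<noteq> False)"
      by auto
  qed
  show ?thesis
    by (rule sum.reindex_bij_witness[where i = T and j = T]) (auto simp: T TT ans simp flip: ans)
qed

text \<open>Couple the two distributions through common source symbols and sum over \<open>r\<close>
  first: for fixed \<open>ws\<close> the sum vanishes without a collision and is at most
  \<open>2^n\<close> otherwise.\<close>

lemma sum_accept_gap_le:
  assumes "valid_plan n D" "finite (set_pmf W)"
  shows "(\<Sum>r\<in>cube n. accept_prob D (map_pmf (codeword n k s (\<lambda>_ _. False) r) W)
      - accept_prob D (map_pmf (codeword n k s c r) W))
    \<le> 2 ^ n * measure (replicate_pmf (num_samples D) W) {ws. \<exists>j. collision k s D j ws}"
proof -
  let ?R = "replicate_pmf (num_samples D) W"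
  let ?d = "\<lambda>c r ws. of_bool (decide D (answers k s c D r ws)) :: real"
  let ?C = "{ws. \<exists>j. collision k s D j ws}"
  note int = integrable_measure_pmf_finite[OF finite_set_replicate_pmf[OF assms(2)]]
  have "(\<Sum>r\<in>cube n. accept_prob D (map_pmf (codeword n k s (\<lambda>_ _. False) r) W)
      - accept_prob D (map_pmf (codeword n k s c r) W))
    = measure_pmf.expectation ?R (\<lambda>ws. \<Sum>r\<in>cube n. ?d (\<lambda>_ _. False) r ws - ?d c r ws)"
    by (simp add: accept_prob_codeword[OF assms(1)] int Bochner_Integration.integral_sum
        Bochner_Integration.integral_diff del: sum_subtractf)
  also have "\<dots> \<le> measure_pmf.expectation ?R (\<lambda>ws. 2 ^ n * indicator ?C ws)"
  proof (rule integral_mono)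
    fix ws
    show "(\<Sum>r\<in>cube n. ?d (\<lambda>_ _. False) r ws - ?d c r ws) \<le> 2 ^ n * indicator ?C ws"
    proof (cases "ws \<in> ?C")
      case True
      have "(\<Sum>r\<in>cube n. ?d (\<lambda>_ _. False) r ws - ?d c r ws) \<le> (\<Sum>r\<in>cube n. 1)"
        by (intro sum_mono) auto
      then show ?thesis using True by (simp add: card_cube)
    next
      case False
      then show ?thesis
        using sum_accept_no_collision[OF assms(1), of k s ws c] by (simp add: sum_subtractf)
    qed
  qed (simp_all add: int)
  finally show ?thesis by simp
qed

definition col_degree :: "plan \<Rightarrow> nat \<Rightarrow> nat" where
  "col_degree D j = card {i. (i, j) \<in> set (queries D)}"

text \<open>Union bound over ordered pairs of distinct samples read in column \<open>j\<close>; both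
  are nonzero with probability \<open>p^2\<close>.\<close>

lemma prob_collision_column:
  assumes "valid_plan n D" "0 \<le> p" "p \<le> 1" "M > 0"
  shows "measure (replicate_pmf (num_samples D) (source p M)) {ws. collision k s D j ws}
    \<le> min 1 ((real (col_degree D j) * p)\<^sup>2)"
proof -
  let ?R = "replicate_pmf (num_samples D) (source p M)"
  let ?I = "{i. (i, j) \<in> set (queries D)}"
  let ?E = "\<lambda>(i, i'). {ws. ws ! i \<in> {w. fst w} \<and> ws ! i' \<in> {w. fst w}} :: (bool \<times> nat) list set"
  let ?J = "(?I \<times> ?I) - Id"
  have finI: "finite ?I"
    by (rule finite_subset[of _ "fst ` set (queries D)"]) force+
  have "measure ?R {ws. collision k s D j ws} \<le> measure ?R (\<Union>x\<in>?J. ?E x)"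
    by (intro measure_pmf.finite_measure_mono) (auto simp: collision_def)
  also have "\<dots> \<le> (\<Sum>x\<in>?J. measure ?R (?E x))"
    using finI by (intro measure_pmf.finite_measure_subadditive_finite) auto
  also have "\<dots> = (\<Sum>x\<in>?J. p\<^sup>2)"
  proof (rule sum.cong[OF refl])
    fix x
    assume "x \<in> ?J"
    then obtain i i' where ii': "x = (i, i')" "i \<noteq> i'"
      "(i, j) \<in> set (queries D)" "(i', j) \<in> set (queries D)"
      by auto
    moreover have "i < num_samples D" "i' < num_samples D"
      using ii' assms(1) by auto
    ultimately show "measure ?R (?E x) = p\<^sup>2"
      using prob_two_nth_replicate_pmf[of i i' "num_samples D" "source p M" "{w. fst w}"]
        prob_source_True[OF assms(2-4)] by simp
  qed
  also have "\<dots> = real (card ?J) * p\<^sup>2"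
    by simp
  also have "\<dots> \<le> (real (col_degree D j) * p)\<^sup>2"
  proof -
    have "card ?J \<le> card (?I \<times> ?I)"
      using finI by (intro card_mono) auto
    then have "real (card ?J) \<le> (real (col_degree D j))\<^sup>2"
      by (simp add: col_degree_def card_cartesian_product power2_eq_square flip: of_nat_mult)
    then show ?thesis by (simp add: power_mult_distrib mult_right_mono)
  qed
  finally show ?thesis by simp
qed

lemma sum_col_degree_le: "(\<Sum>j\<in>snd ` set (queries D). col_degree D j) \<le> length (queries D)"
proof -
  let ?Q = "set (queries D)"
  have "card ?Q = (\<Sum>j\<in>snd ` ?Q. card {x \<in> ?Q. snd x = j})"
    using sum.image_gen[of ?Q "\<lambda>_. 1 :: nat" snd] by simp
  also have "\<dots> = (\<Sum>j\<in>snd ` ?Q. col_degree D j)"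
  proof (rule sum.cong[OF refl])
    fix j
    have "{x \<in> ?Q. snd x = j} = (\<lambda>i. (i, j)) ` {i. (i, j) \<in> ?Q}" by force
    then show "card {x \<in> ?Q. snd x = j} = col_degree D j"
      by (simp add: col_degree_def card_image inj_on_def)
  qed
  finally show ?thesis using card_length[of "queries D"] by simp
qed

text \<open>The residue classes partition the columns, so the union bounds for all \<open>s\<close>
  together charge each queried column once. Averaging over \<open>s\<close> then gains the factor
  \<open>2^-k\<close>.\<close>

lemma sum_prob_collision:
  assumes "valid_plan n D" "0 \<le> p" "p \<le> 1" "M > 0"
  shows "(\<Sum>s<2 ^ k. measure (replicate_pmf (num_samples D) (source p M)) {ws. \<exists>j. collision k s D j ws})
    \<le> (\<Sum>j\<in>snd ` set (queries D). min 1 ((real (col_degree D j) * p)\<^sup>2))"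
proof -
  let ?R = "replicate_pmf (num_samples D) (source p M)"
  let ?J = "snd ` set (queries D)"
  let ?g = "\<lambda>j. min 1 ((real (col_degree D j) * p)\<^sup>2)"
  have "measure ?R {ws. \<exists>j. collision k s D j ws} \<le> (\<Sum>j\<in>{j \<in> ?J. j mod 2 ^ k = s}. ?g j)" for s
  proof -
    have "measure ?R {ws. \<exists>j. collision k s D j ws}
        \<le> measure ?R (\<Union>j\<in>{j \<in> ?J. j mod 2 ^ k = s}. {ws. collision k s D j ws})"
      by (intro measure_pmf.finite_measure_mono) (force simp: collision_def)+
    also have "\<dots> \<le> (\<Sum>j\<in>{j \<in> ?J. j mod 2 ^ k = s}. measure ?R {ws. collision k s D j ws})"
      by (intro measure_pmf.finite_measure_subadditive_finite) auto
    also have "\<dots> \<le> (\<Sum>j\<in>{j \<in> ?J. j mod 2 ^ k = s}. ?g j)"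
      by (intro sum_mono prob_collision_column[OF assms])
    finally show ?thesis .
  qed
  then have "(\<Sum>s<2 ^ k. measure ?R {ws. \<exists>j. collision k s D j ws})
      \<le> (\<Sum>s<2 ^ k. \<Sum>j\<in>{j \<in> ?J. j mod 2 ^ k = s}. ?g j)"
    by (intro sum_mono) auto
  also have "\<dots> = (\<Sum>j\<in>?J. ?g j)"
    by (intro sum.group) auto
  finally show ?thesis .
qed

section \<open>Averaging over all scales and the lower bound\<close>

text \<open>The probability \<open>\<alpha> * 2^k\<close> of a nonzero sample makes up for the
  density \<open>2^-k\<close> of the active columns: \<open>dist_supp_bit_code\<close> gives
  distance at least \<open>\<alpha> / 16\<close> at every scale.\<close>

definition scale_gap :: "nat \<Rightarrow> nat \<Rightarrow> real \<Rightarrow> plan \<Rightarrow> nat \<Rightarrow> nat \<Rightarrow> bool list \<Rightarrow> real" where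
  "scale_gap n m \<alpha> D k s r =
    accept_prob D (map_pmf (codeword n k s (\<lambda>_ _. False) r) (source (\<alpha> * 2 ^ k) (2 * m)))
    - accept_prob D (map_pmf (codeword n k s (bit_code k) r) (source (\<alpha> * 2 ^ k) (2 * m)))"

lemma abs_scale_gap_le: "\<bar>scale_gap n m \<alpha> D k s r\<bar> \<le> 1"
  unfolding scale_gap_def by (smt (verit) accept_prob_bounds)

text \<open>Exchanging the sums over scales and columns, \<open>sum_scales\<close> charges a column
  read in \<open>d\<close> samples only \<open>4 * d * \<alpha>\<close> for all scales together, and
  the degrees add up to at most the number of queries.\<close>

lemma sum_scale_gap_le:
  assumes D: "valid_plan n D" and "m \<ge> 1" "0 \<le> \<alpha>" and small: "\<And>k. k < K \<Longrightarrow> \<alpha> * 2 ^ k \<le> 1"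
  shows "(\<Sum>k<K. (\<Sum>s<2 ^ k. \<Sum>r\<in>cube n. scale_gap n m \<alpha> D k s r) / (2 ^ k * 2 ^ n))
    \<le> 4 * \<alpha> * real (length (queries D))"
proof -
  let ?J = "snd ` set (queries D)"
  let ?d = "\<lambda>j. real (col_degree D j)"
  have "(\<Sum>k<K. (\<Sum>s<2 ^ k. \<Sum>r\<in>cube n. scale_gap n m \<alpha> D k s r) / (2 ^ k * 2 ^ n))
      \<le> (\<Sum>k<K. \<Sum>j\<in>?J. min 1 ((?d j * \<alpha> * 2 ^ k)\<^sup>2) / 2 ^ k)"
  proof (rule sum_mono)
    fix k
    assume "k \<in> {..<K}"
    then have p: "0 \<le> \<alpha> * 2 ^ k" "\<alpha> * 2 ^ k \<le> 1" using small assms by auto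
    let ?W = "source (\<alpha> * 2 ^ k) (2 * m)"
    have "(\<Sum>s<2 ^ k. \<Sum>r\<in>cube n. scale_gap n m \<alpha> D k s r)
        \<le> (\<Sum>s<2 ^ k. 2 ^ n * measure (replicate_pmf (num_samples D) ?W) {ws. \<exists>j. collision k s D j ws})"
      unfolding scale_gap_def using assms
      by (intro sum_mono sum_accept_gap_le[OF D] finite_set_source) auto
    also have "\<dots> \<le> 2 ^ n * (\<Sum>j\<in>?J. min 1 ((?d j * (\<alpha> * 2 ^ k))\<^sup>2))"
      unfolding sum_distrib_left[symmetric]
      using sum_prob_collision[OF D p, of "2 * m" k] assms by (intro mult_left_mono) auto
    finally have "(\<Sum>s<2 ^ k. \<Sum>r\<in>cube n. scale_gap n m \<alpha> D k s r) / (2 ^ k * 2 ^ n)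
        \<le> 2 ^ n * (\<Sum>j\<in>?J. min 1 ((?d j * (\<alpha> * 2 ^ k))\<^sup>2)) / (2 ^ k * 2 ^ n)"
      by (rule divide_right_mono) simp
    also have "\<dots> = (\<Sum>j\<in>?J. min 1 ((?d j * \<alpha> * 2 ^ k)\<^sup>2) / 2 ^ k)"
      by (simp add: mult.assoc flip: sum_divide_distrib)
    finally show "(\<Sum>s<2 ^ k. \<Sum>r\<in>cube n. scale_gap n m \<alpha> D k s r) / (2 ^ k * 2 ^ n)
        \<le> (\<Sum>j\<in>?J. min 1 ((?d j * \<alpha> * 2 ^ k)\<^sup>2) / 2 ^ k)" .
  qed
  also have "\<dots> = (\<Sum>j\<in>?J. \<Sum>k<K. min 1 ((?d j * \<alpha> * 2 ^ k)\<^sup>2) / 2 ^ k)"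
    by (rule sum.swap)
  also have "\<dots> \<le> (\<Sum>j\<in>?J. 4 * (?d j * \<alpha>))"
    using assms by (intro sum_mono sum_scales) auto
  also have "\<dots> = 4 * \<alpha> * real (\<Sum>j\<in>?J. col_degree D j)"
    by (simp add: sum_distrib_left mult_ac)
  also have "\<dots> \<le> 4 * \<alpha> * real (length (queries D))"
    using sum_col_degree_le[of D] assms by (intro mult_left_mono of_nat_mono) auto
  finally show ?thesis .
qed

text \<open>A correct test needs an average gap above 1/3 at each of the \<open>K\<close> scales,
  while a single plan has total gap at most \<open>4 * 32 * \<epsilon> * B\<close> over all
  scales.\<close>

lemma queries_lower_bound:
  assumes test: "nonadaptive_test n m \<epsilon> A" and "m \<ge> 2" "\<epsilon> > 0"
    and "K > 0" and small: "\<And>k. k < K \<Longrightarrow> 32 * \<epsilon> * 2 ^ k \<le> 1" and n: "2 ^ (K + 2 * m) \<le> n"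
    and B: "\<And>D. D \<in> set_pmf A \<Longrightarrow> real (length (queries D)) \<le> B"
  shows "real K / 3 < 128 * \<epsilon> * B"
proof -
  let ?g = "scale_gap n m (32 * \<epsilon>)"
  \<comment> \<open>Each scale contributes an average over \<open>2^k\<close> residues and
    \<open>2^n\<close> strings, so the constant 1/3 sums to \<open>K / 3\<close>.\<close>
  let ?S = "\<lambda>f. \<Sum>k<K. (\<Sum>s<(2 :: nat) ^ k. \<Sum>r\<in>cube n. f k s r) / (2 ^ k * 2 ^ n) :: real"
  have int: "integrable A (\<lambda>D. ?g D k s r)" for k s r
    by (rule measure_pmf.integrable_const_bound[where B = 1]) (simp_all add: abs_scale_gap_le)
  have gap: "1 / 3 < measure_pmf.expectation A (\<lambda>D. ?g D k s r)" if "k < K" "s < 2 ^ k" for k s r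
    unfolding scale_gap_def
  proof (rule nonadaptive_test_gap[OF test])
    have "2 ^ (k + 2 * m) \<le> (2::nat) ^ (K + 2 * m)"
      using that by (intro power_increasing) auto
    also note n
    finally have "2 ^ (k + 2 * m) \<le> n" .
    \<comment> \<open>The left side equals \<open>2 * \<epsilon>\<close>, which gives the strict
      inequality in the definition of being far.\<close>
    then have "32 * \<epsilon> * 2 ^ k / (16 * 2 ^ k)
        \<le> dist_supp n m (map_pmf (codeword n k s (bit_code k) r) (source (32 * \<epsilon> * 2 ^ k) (2 * m)))"
      using assms that small[of k] by (intro dist_supp_bit_code) auto
    then show "\<epsilon> < dist_supp n m
        (map_pmf (codeword n k s (bit_code k) r) (source (32 * \<epsilon> * 2 ^ k) (2 * m)))"
      using \<open>\<epsilon> > 0\<close> by simp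
  qed (use \<open>m \<ge> 2\<close> in \<open>auto simp: cube_def intro: codeword_zero_code_in_supp_at_most\<close>)
  have nonempty: "cube n \<noteq> {}"
    using card_cube[of n] by (metis card.empty power_not_zero zero_neq_numeral)
  have "real K / 3 = ?S (\<lambda>_ _ _. 1 / 3)"
    by (simp add: card_cube)
  also have "\<dots> < ?S (\<lambda>k s r. measure_pmf.expectation A (\<lambda>D. ?g D k s r))"
    using \<open>K > 0\<close> nonempty
    by (intro sum_strict_mono divide_strict_right_mono gap finite_cube) (auto simp: lessThan_empty_iff)
  also have "\<dots> = measure_pmf.expectation A (\<lambda>D. ?S (?g D))"
    by (simp add: int Bochner_Integration.integral_sum)
  also have "\<dots> \<le> measure_pmf.expectation A (\<lambda>_. 128 * \<epsilon> * B)"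
  proof (rule integral_mono_AE)
    have "?S (?g D) \<le> 128 * \<epsilon> * B" if "D \<in> set_pmf A" for D
    proof -
      have "valid_plan n D"
        using test that by (simp add: nonadaptive_test_def nonadaptive_alg_def)
      then have "?S (?g D) \<le> 4 * (32 * \<epsilon>) * real (length (queries D))"
        using assms by (intro sum_scale_gap_le) auto
      also have "\<dots> \<le> 128 * \<epsilon> * B"
        using B[OF that] \<open>\<epsilon> > 0\<close> by simp
      finally show ?thesis .
    qed
    then show "AE D in A. ?S (?g D) \<le> 128 * \<epsilon> * B"
      by (simp add: AE_measure_pmf_iff)
  qed (simp_all add: int)
  finally show ?thesis by simp
qed

theorem theorem5p1:
  "\<exists>c::real. c > 0 \<and> (\<exists>\<epsilon>\<^sub>0::real. \<epsilon>\<^sub>0 > 0 \<and>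
    (\<forall>m::nat. m \<ge> 2 \<longrightarrow> (\<forall>\<epsilon>::real. 0 < \<epsilon> \<and> \<epsilon> < \<epsilon>\<^sub>0 \<longrightarrow>
      (\<exists>N::nat. \<forall>n\<ge>N. \<forall>A. nonadaptive_test n m \<epsilon> A \<longrightarrow>
        query_complexity A \<ge> ereal (c * (1 / \<epsilon>) * log 2 (1 / \<epsilon>))))))"
proof (rule exI[of _ "1 / 1000"], intro conjI exI[of _ "1 / 2 ^ 10"] allI impI)
  fix m :: nat and \<epsilon> :: real
  assume m: "m \<ge> 2" and \<epsilon>: "0 < \<epsilon> \<and> \<epsilon> < 1 / 2 ^ 10"
  let ?L = "log 2 (1 / \<epsilon>)"
  \<comment> \<open>Then \<open>k < K\<close> implies \<open>k + 5 \<le> ?L\<close>, that is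
    \<open>32 * \<epsilon> * 2^k \<le> 1\<close>, so that every scale has a legitimate
    probability.\<close>
  define K where "K = nat \<lfloor>?L - 4\<rfloor>"
  have L: "?L > 10"
    using \<epsilon> by (subst less_log_iff) (auto simp: powr_numeral field_simps)
  then have K: "real K \<le> ?L - 4" "?L - 5 \<le> real K"
    unfolding K_def by linarith+
  have small: "32 * \<epsilon> * 2 ^ k \<le> 1" if "k < K" for k
  proof -
    have "real k + 5 \<le> ?L" using that K by linarith
    then have "2 powr (real k + 5) \<le> 1 / \<epsilon>"
      using \<epsilon> by (simp add: le_log_iff)
    then show ?thesis using \<epsilon> by (simp add: powr_add powr_realpow powr_numeral field_simps)
  qed
  show "\<exists>N. \<forall>n\<ge>N. \<forall>A. nonadaptive_test n m \<epsilon> A \<longrightarrow>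
      query_complexity A \<ge> ereal (1 / 1000 * (1 / \<epsilon>) * ?L)"
  proof (intro exI[of _ "2 ^ (K + 2 * m)"] allI impI, rule ccontr)
    fix n A
    assume n: "2 ^ (K + 2 * m) \<le> n" and A: "nonadaptive_test n m \<epsilon> A"
      and "\<not> ereal (1 / 1000 * (1 / \<epsilon>) * ?L) \<le> query_complexity A"
    then have "ereal (real (length (queries D))) \<le> ereal (1 / 1000 * (1 / \<epsilon>) * ?L)"
      if "D \<in> set_pmf A" for D
      using SUP_upper[OF that, of "\<lambda>D. ereal (real (length (queries D)))"]
      unfolding query_complexity_def by (meson le_less_trans less_imp_le not_le)
    then have "real K / 3 < 128 * \<epsilon> * (1 / 1000 * (1 / \<epsilon>) * ?L)"
      using \<epsilon> m L K by (intro queries_lower_bound[OF A _ _ _ small n]) auto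
    \<comment> \<open>This contradicts \<open>?L > 10\<close>, since \<open>K\<close> is at least
      \<open>?L - 5 > ?L / 2\<close> and \<open>?L / 6\<close> already exceeds
      \<open>128 / 1000 * ?L\<close>.\<close>
    also have "\<dots> = 128 / 1000 * ?L" using \<epsilon> by simp
    finally show False using K L by simp
  qed
qed simp_all

end
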